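(* Let $n\ge 1$, $E\in\mathbb{H}\setminus\{0\}$ and $v(0,0),\dots,v(0,n-1)\in\mathbb{H}\setminus\mathbb{S}^2$ be such that $\det\vec M(0)\neq0$. Then the following steps can be iterated, starting from $i=0$: 1. If $i=0$, choose $u(0)$ as one of the two fixed points of $M(0)$. If $i>0$, choose $u(i)$ as the unique fixed point of $M(i)$ for which $u(i)\neq-u(i-1)$. 2. Use the parallelogram evolution to construct $v(i+1,0),\dots,v(i+1,n-1)$, that is, put $u(i,0)=u(i)$ and for $l=0,\dots,n-1$ $$u(i,l+1)=(v(i,l)-u(i,l))\,u(i,l)\,(v(i,l)-u(i,l))^{-1},\qquad v(i+1,l)=(v(i,l)-u(i,l))\,v(i,l)\,(v(i,l)-u(i,l))^{-1}.$$ The curve $\gamma$ with edges $\gamma(i+1)-\gamma(i)=u(i)$ is an $n$-invariant curve. Conversely, any $n$-invariant curve can be obtained this way.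
   Context: $\mathbb{H}$ denotes the quaternions, $\vec q=\operatorname{Im}(q)$, $r_q=\operatorname{Re}(q)$, $\operatorname{Im}(\mathbb{H})\cong\mathbb{R}^3$, and $\mathbb{S}^2=\{p\in\mathbb{H}: p^2=-1\}$ is the set of imaginary unit quaternions. Matrices. For $A,B\in\mathbb{H}$ let $M=\begin{pmatrix}A&B\\-B&A\end{pmatrix}$. Its complex determinant is $\det M=|B|^2-|A|^2-2\langle A,B\rangle_4\,\mathrm{i}\in\mathbb{C}$, where $\langle A,B\rangle_4$ is the standard scalar product on $\mathbb{H}\cong\mathbb{R}^4$, and $\vec M=\begin{pmatrix}\vec A&\vec B\\-\vec B&\vec A\end{pmatrix}$. If $\det M\ne0$, then $M$ defines a map $\mathbb{S}^2\to\mathbb{S}^2$, $u\mapsto(A-Bu)u(A-Bu)^{-1}$; fixed points of $M$ are fixed points of this map. For $v\in\mathbb{H}\setminus\mathbb{S}^2$ put $T_v=\begin{pmatrix}v&1\\-1&v\end{pmatrix}$; it acts on $\mathbb{S}^2$ by $u\mapsto(v-u)u(v-u)^{-1}$. Define $$M(k)=\begin{pmatrix}E&0\\0&E\end{pmatrix}T_{v(k,n-1)}\cdots T_{v(k,0)}.$$ Curves. A discrete curve is a map $\gamma:\mathbb{Z}\to\operatorname{Im}(\mathbb{H})$ with edges $u(k)=\gamma(k+1)-\gamma(k)$. It is arc-length parametrized if $|u(k)|=1$ for all $k$ (i.e. $u(k)\in\mathbb{S}^2$), and regular if $\gamma(k-1)\neq\gamma(k+1)$ for all $k$. For brevity curves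 produced by the algorithm are considered for indices $i\ge0$ (the extension to $i<0$ is analogous, using the other fixed point). A Bäcklund transformation of a curve with edges $u$ is given by quaternions $v(k)\in\mathbb{H}\setminus\mathbb{S}^2$ at the vertices and a curve with edges $\tilde u(k)\in\mathbb{S}^2$ such that $u(k)+v(k+1)=v(k)+\tilde u(k)$ and $v(k+1)u(k)=\tilde u(k)v(k)$ for all $k$. For a sequence of $n$ Bäcklund transformations write $u(k,l)$ for the edges of the $l$-th transform ($u(k,0)=u(k)$, $\tilde u(k)=u(k,n)$) and $v(k,l)$ for the quaternion of the transformation from the $l$-th to the $(l+1)$-st curve. A regular arc-length parametrized curve $\gamma$ is $n$-invariant if there exists a sequence of $n$ Bäcklund transformations of $\gamma$ such that the $n$-th transform $\tilde\gamma$ is related to $\gamma$ by a Euclidean motion, acting on edges as a rotation $u=E\tilde uE^{-1}$ with some $E\in\mathbb{H}\setminus\{0\}$, for which the map $M=M(k)=\begin{pmatrix}E&0\\0&E\end{pmatrix}T_{v(k,n-1)}\cdots T_{v(k,0)}$, formed with this $E$ and the quaternions $v(k,l)$ of these $n$ Bäcklund transformations, is not the identity (i.e. $\vec M\neq0$). *)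

theory Defs
  imports "HOL-Analysis.Analysis"
begin

section \<open>The quaternions as a normed division algebra\<close>

datatype quat = Quat (qre: real) (qi: real) (qj: real) (qk: real)

lemma quat_eq_iff: "p = q \<longleftrightarrow> qre p = qre q \<and> qi p = qi q \<and> qj p = qj q \<and> qk p = qk q"
  by (cases p; cases q) simp

lemma quat_eqI: "qre p = qre q \<Longrightarrow> qi p = qi q \<Longrightarrow> qj p = qj q \<Longrightarrow> qk p = qk q \<Longrightarrow> p = q"
  by (simp add: quat_eq_iff)

instantiation quat :: ring_1
begin

definition "0 = Quat 0 0 0 0"
definition "1 = Quat 1 0 0 0"
definition "p + q = Quat (qre p + qre q) (qi p + qi q) (qj p + qj q) (qk p + qk q)"
definition "p - q = Quat (qre p - qre q) (qi p - qi q) (qj p - qj q) (qk p - qk q)"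
definition "- q = Quat (- qre q) (- qi q) (- qj q) (- qk q)"
definition "p * q = Quat
  (qre p * qre q - qi p * qi q - qj p * qj q - qk p * qk q)
  (qre p * qi q + qi p * qre q + qj p * qk q - qk p * qj q)
  (qre p * qj q - qi p * qk q + qj p * qre q + qk p * qi q)
  (qre p * qk q + qi p * qj q - qj p * qi q + qk p * qre q)"

lemmas quat_ring_defs = zero_quat_def one_quat_def plus_quat_def minus_quat_def
  uminus_quat_def times_quat_def

instance
  by standard (auto simp: quat_ring_defs quat_eq_iff algebra_simps)

end

lemma quat_sel_simps [simp]:
  "qre 0 = 0" "qi 0 = 0" "qj 0 = 0" "qk 0 = 0"
  "qre 1 = 1" "qi 1 = 0" "qj 1 = 0" "qk 1 = 0"
  "qre (p + q) = qre p + qre q" "qi (p + q) = qi p + qi q"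
  "qj (p + q) = qj p + qj q" "qk (p + q) = qk p + qk q"
  "qre (p - q) = qre p - qre q" "qi (p - q) = qi p - qi q"
  "qj (p - q) = qj p - qj q" "qk (p - q) = qk p - qk q"
  "qre (- q) = - qre q" "qi (- q) = - qi q" "qj (- q) = - qj q" "qk (- q) = - qk q"
  "qre (p * q) = qre p * qre q - qi p * qi q - qj p * qj q - qk p * qk q"
  "qi (p * q) = qre p * qi q + qi p * qre q + qj p * qk q - qk p * qj q"
  "qj (p * q) = qre p * qj q - qi p * qk q + qj p * qre q + qk p * qi q"
  "qk (p * q) = qre p * qk q + qi p * qj q - qj p * qi q + qk p * qre q"
  by (simp_all add: quat_ring_defs)

instantiation quat :: real_inner
begin

definition "scaleR r q = Quat (r * qre q) (r * qi q) (r * qj q) (r * qk q)"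
definition "inner p q = qre p * qre q + qi p * qi q + qj p * qj q + qk p * qk q"
definition norm_quat_def': "norm (q::quat) = sqrt (inner q q)"
definition "sgn (q::quat) = scaleR (inverse (norm q)) q"
definition "dist (p::quat) q = norm (p - q)"
definition "(uniformity :: (quat \<times> quat) filter) = (INF e\<in>{0 <..}. principal {(x, y). dist x y < e})"
definition "open (U :: quat set) \<longleftrightarrow> (\<forall>x\<in>U. eventually (\<lambda>(x', y). x' = x \<longrightarrow> y \<in> U) uniformity)"

lemma quat_scaleR_sel [simp]:
  "qre (scaleR r q) = r * qre q" "qi (scaleR r q) = r * qi q"
  "qj (scaleR r q) = r * qj q" "qk (scaleR r q) = r * qk q"
  by (simp_all add: scaleR_quat_def)

instance
proof
  fix x y z :: quat and r s :: real and U :: "quat set"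
  show "r *\<^sub>R (x + y) = r *\<^sub>R x + r *\<^sub>R y" "(r + s) *\<^sub>R x = r *\<^sub>R x + s *\<^sub>R x"
    "r *\<^sub>R s *\<^sub>R x = (r * s) *\<^sub>R x" "1 *\<^sub>R x = x"
    by (auto simp: quat_eq_iff algebra_simps)
  show "inner x y = inner y x" "inner (x + y) z = inner x z + inner y z"
    "inner (r *\<^sub>R x) y = r * inner x y"
    by (auto simp: inner_quat_def algebra_simps)
  show "0 \<le> inner x x"
    by (simp add: inner_quat_def)
  show "inner x x = 0 \<longleftrightarrow> x = 0"
    by (auto simp: inner_quat_def quat_eq_iff add_nonneg_eq_0_iff)
qed (simp_all only: norm_quat_def' sgn_quat_def dist_quat_def uniformity_quat_def open_quat_def)

end

lemma norm_quat_sq: "(norm (q::quat))\<^sup>2 = (qre q)\<^sup>2 + (qi q)\<^sup>2 + (qj q)\<^sup>2 + (qk q)\<^sup>2"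
  by (simp add: norm_quat_def' inner_quat_def power2_eq_square add_nonneg_nonneg)

instantiation quat :: real_normed_div_algebra
begin

definition inverse_quat_def:
  "inverse q = scaleR (inverse ((norm q)\<^sup>2)) (Quat (qre q) (- qi q) (- qj q) (- qk q))"
definition divide_quat_def: "p div (q::quat) = p * inverse q"

instance
proof
  fix x y :: quat and r :: real
  show "r *\<^sub>R x * y = r *\<^sub>R (x * y)" "x * r *\<^sub>R y = r *\<^sub>R (x * y)"
    by (auto simp: quat_eq_iff algebra_simps)
  show "x div y = x * inverse y"
    by (rule divide_quat_def)
  show "inverse (0::quat) = 0"
    by (simp add: inverse_quat_def)
  define c where "c = inverse ((norm x)\<^sup>2)"
  have c: "c * (qre x * qre x + qi x * qi x + qj x * qj x + qk x * qk x) = 1" if "x \<noteq> 0"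
  proof -
    have "qre x * qre x + qi x * qi x + qj x * qj x + qk x * qk x = (norm x)\<^sup>2"
      unfolding norm_quat_sq by (simp add: power2_eq_square)
    then show ?thesis using that by (simp add: c_def)
  qed
  show "inverse x * x = 1" if "x \<noteq> 0"
    using c[OF that] by (simp add: inverse_quat_def quat_eq_iff c_def[symmetric] algebra_simps)
  show "x * inverse x = 1" if "x \<noteq> 0"
    using c[OF that] by (simp add: inverse_quat_def quat_eq_iff c_def[symmetric] algebra_simps)
  have "(norm (x * y))\<^sup>2 = (norm x * norm y)\<^sup>2"
    unfolding power_mult_distrib norm_quat_sq quat_sel_simps by algebra
  then show "norm (x * y) = norm x * norm y"
    by (simp add: power2_eq_iff_nonneg)
qed

end

definition qim :: "quat \<Rightarrow> quat" where
  "qim q = Quat 0 (qi q) (qj q) (qk q)"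

definition Im_quat :: "quat set" where
  "Im_quat = {q. qre q = 0}"

definition S2 :: "quat set" where
  "S2 = {p. p\<^sup>2 = - 1}"

section \<open>Matrices and their action on the sphere\<close>

definition qmat :: "quat \<Rightarrow> quat \<Rightarrow> quat^2^2" where
  "qmat A B = vector [vector [A, B], vector [- B, A]]"

text \<open>
  The three notions below are only meant for matrices of the form \<^term>\<open>qmat A B\<close>, a class
  that is closed under products; \<open>A\<close> and \<open>B\<close> are read off from the first row.
\<close>

definition cdet :: "quat^2^2 \<Rightarrow> complex" where
  "cdet M = (let A = M $ 1 $ 1; B = M $ 1 $ 2 in
     Complex ((norm B)\<^sup>2 - (norm A)\<^sup>2) (- 2 * inner A B))"

definition vec_part :: "quat^2^2 \<Rightarrow> quat^2^2" where
  "vec_part M = (\<chi> i j. qim (M $ i $ j))"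

definition act :: "quat^2^2 \<Rightarrow> quat \<Rightarrow> quat" where
  "act M u = (let A = M $ 1 $ 1; B = M $ 1 $ 2 in (A - B * u) * u * inverse (A - B * u))"

definition fixed_point :: "quat^2^2 \<Rightarrow> quat \<Rightarrow> bool" where
  "fixed_point M u \<longleftrightarrow> cdet M \<noteq> 0 \<and> u \<in> S2 \<and> act M u = u"

definition T :: "quat \<Rightarrow> quat^2^2" where
  "T v = qmat v 1"

primrec T_prod :: "(nat \<Rightarrow> quat) \<Rightarrow> nat \<Rightarrow> quat^2^2" where
  "T_prod v 0 = mat 1"
| "T_prod v (Suc l) = T (v l) ** T_prod v l"

definition monodromy :: "nat \<Rightarrow> quat \<Rightarrow> (nat \<Rightarrow> quat) \<Rightarrow> quat^2^2" where
  "monodromy n E v = qmat E 0 ** T_prod v n"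

section \<open>Discrete curves and invariance under Baecklund transformations\<close>

definition discrete_curve :: "(int \<Rightarrow> quat) \<Rightarrow> bool" where
  "discrete_curve \<gamma> \<longleftrightarrow> (\<forall>k. \<gamma> k \<in> Im_quat)"

definition edge :: "(int \<Rightarrow> quat) \<Rightarrow> int \<Rightarrow> quat" where
  "edge \<gamma> k = \<gamma> (k + 1) - \<gamma> k"

definition arc_length_parametrized :: "(int \<Rightarrow> quat) \<Rightarrow> bool" where
  "arc_length_parametrized \<gamma> \<longleftrightarrow> (\<forall>k. norm (edge \<gamma> k) = 1)"

definition regular_curve :: "(int \<Rightarrow> quat) \<Rightarrow> bool" where
  "regular_curve \<gamma> \<longleftrightarrow> (\<forall>k. \<gamma> (k - 1) \<noteq> \<gamma> (k + 1))"

definition baecklund :: "(int \<Rightarrow> quat) \<Rightarrow> (int \<Rightarrow> quat) \<Rightarrow> (int \<Rightarrow> quat) \<Rightarrow> bool" where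
  "baecklund u v u' \<longleftrightarrow> (\<forall>k. v k \<notin> S2 \<and> u' k \<in> S2
     \<and> u k + v (k + 1) = v k + u' k \<and> v (k + 1) * u k = u' k * v k)"

text \<open>
  In \<open>u k l\<close> and \<open>v k l\<close> the first argument is the position along the curve and the second one
  the number of the transform.
\<close>

definition n_invariant :: "nat \<Rightarrow> (int \<Rightarrow> quat) \<Rightarrow> bool" where
  "n_invariant n \<gamma> \<longleftrightarrow>
     discrete_curve \<gamma> \<and> arc_length_parametrized \<gamma> \<and> regular_curve \<gamma> \<and>
     (\<exists>(u :: int \<Rightarrow> nat \<Rightarrow> quat) (v :: int \<Rightarrow> nat \<Rightarrow> quat) E.
        (\<forall>k. u k 0 = edge \<gamma> k) \<and>
        (\<forall>l<n. baecklund (\<lambda>k. u k l) (\<lambda>k. v k l) (\<lambda>k. u k (Suc l))) \<and>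
        E \<noteq> 0 \<and> (\<forall>k. u k 0 = E * u k n * inverse E) \<and>
        (\<forall>k. vec_part (monodromy n E (v k)) \<noteq> 0))"

section \<open>The algorithm\<close>

text \<open>
  \<open>evolve_u v w l\<close> and \<open>evolve_v v w l\<close> are \<open>u(i,l)\<close> and \<open>v(i+1,l)\<close> of the parallelogram evolution
  for \<open>v = v(i,\<cdot>)\<close> and \<open>w = u(i)\<close>.
\<close>

primrec evolve_u :: "(nat \<Rightarrow> quat) \<Rightarrow> quat \<Rightarrow> nat \<Rightarrow> quat" where
  "evolve_u v w 0 = w"
| "evolve_u v w (Suc l) =
     (v l - evolve_u v w l) * evolve_u v w l * inverse (v l - evolve_u v w l)"

definition evolve_v :: "(nat \<Rightarrow> quat) \<Rightarrow> quat \<Rightarrow> nat \<Rightarrow> quat" where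
  "evolve_v v w l = (v l - evolve_u v w l) * v l * inverse (v l - evolve_u v w l)"

definition admissible :: "nat \<Rightarrow> quat \<Rightarrow> (nat \<Rightarrow> quat) \<Rightarrow> bool" where
  "admissible n E v0 \<longleftrightarrow>
     E \<noteq> 0 \<and> (\<forall>l<n. v0 l \<notin> S2) \<and> cdet (vec_part (monodromy n E v0)) \<noteq> 0"

text \<open>
  \<open>edge_choice n E u v i w\<close>: in step \<open>i\<close> the algorithm may put \<open>u(i) = w\<close>, where \<open>v i\<close> is \<open>v(i,\<cdot>)\<close>.
\<close>

definition edge_choice ::
    "nat \<Rightarrow> quat \<Rightarrow> (nat \<Rightarrow> quat) \<Rightarrow> (nat \<Rightarrow> nat \<Rightarrow> quat) \<Rightarrow> nat \<Rightarrow> quat \<Rightarrow> bool" where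
  "edge_choice n E u v i w \<longleftrightarrow>
     fixed_point (monodromy n E (v i)) w \<and> (i > 0 \<longrightarrow> w \<noteq> - u (i - 1))"

text \<open>A run of the iterations \<open>0, \<dots>, N - 1\<close>, and an infinite run.\<close>

definition run_upto ::
    "nat \<Rightarrow> quat \<Rightarrow> (nat \<Rightarrow> quat) \<Rightarrow> nat \<Rightarrow> (nat \<Rightarrow> quat) \<Rightarrow> (nat \<Rightarrow> nat \<Rightarrow> quat) \<Rightarrow> bool" where
  "run_upto n E v0 N u v \<longleftrightarrow>
     (\<forall>l<n. v 0 l = v0 l) \<and>
     (\<forall>i<N. edge_choice n E u v i (u i) \<and> (\<forall>l<n. v (Suc i) l = evolve_v (v i) (u i) l))"

definition run ::
    "nat \<Rightarrow> quat \<Rightarrow> (nat \<Rightarrow> quat) \<Rightarrow> (nat \<Rightarrow> quat) \<Rightarrow> (nat \<Rightarrow> nat \<Rightarrow> quat) \<Rightarrow> bool" where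
  "run n E v0 u v \<longleftrightarrow> (\<forall>N. run_upto n E v0 N u v)"

text \<open>
  A run only yields the edges with index \<open>i \<ge> 0\<close>. The edges with negative index are obtained by
  traversing the curve backwards, which replaces the edges \<open>u(-1), u(-2), \<dots>\<close> by
  \<open>-u(-1), -u(-2), \<dots>\<close>: the latter form a run with the same initial data that starts with the
  other fixed point of \<open>M(0)\<close>.
\<close>

definition curve_of_run ::
    "nat \<Rightarrow> quat \<Rightarrow> (nat \<Rightarrow> quat) \<Rightarrow> (nat \<Rightarrow> quat) \<Rightarrow> (int \<Rightarrow> quat) \<Rightarrow> bool" where
  "curve_of_run n E v0 u \<gamma> \<longleftrightarrow>
     discrete_curve \<gamma> \<and> (\<forall>i. edge \<gamma> (int i) = u i) \<and>
     (\<exists>u' v'. run n E v0 u' v' \<and> u' 0 \<noteq> u 0 \<and> (\<forall>i. edge \<gamma> (- int i - 1) = - u' i))"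

end

theory Submission
  imports Defs
begin

text \<open>
  A point \<open>w\<close> of the sphere is fixed by \<open>M = qmat A B\<close> iff the multiplier \<open>m = A - B w\<close> commutes
  with \<open>w\<close>, that is, iff \<open>m = r - s w\<close> with real \<open>r\<close> and \<open>s\<close>; then \<open>r + \<i> s\<close> is an eigenvalue of
  \<open>M\<close>. For the vector part of \<open>M\<close> the eigenvalues are the two square roots of its determinant,
  whence there are exactly two fixed points if this determinant is nonzero; conversely, two fixed
  points and \<open>vec_part M \<noteq> 0\<close> force it to be nonzero.

  A parallelogram with edges \<open>u, v, u', v'\<close> is the zero curvature relation \<open>T v' T u = T u' T v\<close>. If
  \<open>u(i)\<close> is fixed by \<open>M(i)\<close>, these relations combine to \<open>M(i + 1) T u(i) = T u(i) M(i)\<close>. Although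
  \<open>T u(i)\<close> is singular, evaluating multipliers at the fixed point of \<open>M(i)\<close> other than \<open>u(i)\<close> shows
  that the eigenvalues are preserved, so \<open>M(i + 1)\<close> again has two fixed points. One of them is
  \<open>- u(i)\<close>, because the parallelogram evolution is reversed by changing the sign of the edges. The
  same reversal gives the edges with negative index, and in the converse direction it exhibits
  \<open>- u(k - 1)\<close> and \<open>u(k)\<close> as fixed points of \<open>M(k)\<close>, which are distinct by regularity.
\<close>

section \<open>Quaternions and the sphere\<close>

lemma S2_iff: "q \<in> S2 \<longleftrightarrow> qre q = 0 \<and> norm q = 1"
proof
  assume "q \<in> S2"
  then have q: "q * q = - 1"
    by (simp add: S2_def power2_eq_square)
  then have "norm q * norm q = 1"
    by (metis norm_mult norm_minus_cancel norm_one)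
  then have n: "norm q = 1"
    using norm_ge_zero[of q] by (metis abs_of_nonneg mult_1 power2_eq_square real_sqrt_abs real_sqrt_one)
  have "qre q * qre q - qi q * qi q - qj q * qj q - qk q * qk q = - 1"
    using arg_cong[OF q, of qre] by simp
  then have "qre q * qre q = 0"
    using norm_quat_sq[of q] unfolding n power2_eq_square by linarith
  then show "qre q = 0 \<and> norm q = 1"
    using n by simp
next
  assume q: "qre q = 0 \<and> norm q = 1"
  then have "qi q * qi q + qj q * qj q + qk q * qk q = 1"
    using norm_quat_sq[of q] by (simp add: power2_eq_square)
  then show "q \<in> S2"
    using q by (simp add: S2_def power2_eq_square quat_eq_iff algebra_simps)
qed

lemma S2_square: "u \<in> S2 \<Longrightarrow> u * u = - 1"
  by (simp add: S2_def power2_eq_square)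

lemma S2_uminus [simp]: "- u \<in> S2 \<longleftrightarrow> u \<in> S2"
  by (simp add: S2_iff)

lemma conj_eq_iff:
  fixes c x y :: "'a :: division_ring"
  assumes "c \<noteq> 0"
  shows "y = c * x * inverse c \<longleftrightarrow> y * c = c * x"
proof
  assume "y * c = c * x"
  then have "c * x * inverse c = y * (c * inverse c)"
    by (metis mult.assoc)
  then show "y = c * x * inverse c"
    using assms by simp
qed (simp add: assms mult.assoc)

lemma conj_in_S2_iff [simp]:
  assumes "c \<noteq> 0"
  shows "c * x * inverse c \<in> S2 \<longleftrightarrow> x \<in> S2"
proof -
  have "c * x * inverse c * (c * x * inverse c) = c * (x * x) * inverse c"
    using assms by (metis (no_types, lifting) left_inverse mult.assoc mult.right_neutral)
  moreover have "c * y * inverse c = - 1 \<longleftrightarrow> y = - 1" for y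
    using conj_eq_iff[OF assms, of "- 1" y] assms
    by (metis mult_left_cancel mult_minus1 mult_minus1_right)
  ultimately show ?thesis
    by (simp add: S2_def power2_eq_square)
qed

text \<open>The real part of \<open>inverse x * y\<close> is the scalar product divided by
  \<open>(norm x)\<^sup>2\<close>, so orthogonality makes the quotient imaginary and equal lengths
  make it a unit.\<close>

lemma inverse_mult_in_S2:
  fixes x y :: quat
  assumes "x \<noteq> 0" "norm x = norm y" "inner x y = 0"
  shows "inverse x * y \<in> S2"
proof -
  have "qre (inverse x * y) = inverse ((norm x)\<^sup>2) * inner x y"
    by (simp add: inverse_quat_def inner_quat_def algebra_simps)
  moreover have "norm (inverse x * y) = 1"
    using assms by (metis left_inverse norm_eq_zero norm_inverse norm_mult)
  ultimately show ?thesis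
    using assms by (simp add: S2_iff)
qed

text \<open>The minus sign reflects that the multiplier below substitutes \<open>- w\<close> for the central
  imaginary unit.\<close>

definition complex_on :: "quat \<Rightarrow> complex \<Rightarrow> quat" where
  "complex_on w z = of_real (Re z) - of_real (Im z) * w"

lemma of_real_quat: "of_real r = Quat r 0 0 0"
  by (simp add: of_real_def quat_eq_iff)

lemma of_real_quat_sel [simp]:
  "qre (of_real r) = r" "qi (of_real r) = 0" "qj (of_real r) = 0" "qk (of_real r) = 0"
  by (simp_all add: of_real_quat)

lemma of_real_quat_commute: "of_real r * q = q * (of_real r :: quat)"
  by (simp add: quat_eq_iff)

lemma complex_on_diff: "complex_on w (y - z) = complex_on w y - complex_on w z"
  by (simp add: complex_on_def algebra_simps)

lemma complex_on_mult:
  assumes "w \<in> S2"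
  shows "complex_on w (y * z) = complex_on w y * complex_on w z"
proof -
  have "of_real r * w * (of_real s * w) = of_real r * of_real s * (w * w)" for r s
    by (metis mult.assoc of_real_quat_commute)
  then have 1: "of_real r * w * (of_real s * w) = - of_real (r * s)" for r s
    by (simp add: S2_square[OF assms])
  have 2: "of_real r * w * of_real s = of_real (r * s) * w"
    "of_real r * (of_real s * w) = of_real (r * s) * w" for r s
    by (simp_all add: mult.assoc flip: of_real_quat_commute[of s w])
  show ?thesis
    unfolding complex_on_def left_diff_distrib right_diff_distrib 1 2
    by (simp add: algebra_simps)
qed

lemma complex_on_eq_0_iff:
  assumes "w \<in> S2"
  shows "complex_on w z = 0 \<longleftrightarrow> z = 0"
proof
  assume *: "complex_on w z = 0"
  have w: "qre w = 0" "w \<noteq> 0"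
    using assms by (auto simp: S2_iff)
  then have "Re z = 0"
    using arg_cong[OF *, of qre] by (simp add: complex_on_def)
  moreover from this have "Im z = 0"
    using * w by (simp add: complex_on_def)
  ultimately show "z = 0"
    by (simp add: complex_eq_iff)
qed (simp add: complex_on_def)

lemma complex_on_eq_iff: "w \<in> S2 \<Longrightarrow> complex_on w y = complex_on w z \<longleftrightarrow> y = z"
  using complex_on_eq_0_iff[of w "y - z"] by (simp add: complex_on_diff)

lemma complex_on_conj:
  assumes "c * w = w' * c"
  shows "c * complex_on w z = complex_on w' z * c"
proof -
  have "c * (of_real (Im z) * w) = of_real (Im z) * (w' * c)"
    by (metis assms mult.assoc of_real_quat_commute)
  then show ?thesis
    by (simp add: complex_on_def left_diff_distrib right_diff_distrib mult.assoc
        of_real_quat_commute[of "Re z" c])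
qed

lemma complex_on_commute: "x * w = w * x \<Longrightarrow> x * complex_on w z = complex_on w z * x"
  by (rule complex_on_conj)

text \<open>The centralizer of an imaginary unit is the plane spanned by \<open>1\<close> and
  \<open>w\<close>: commuting means that the cross product of the imaginary parts vanishes.\<close>

lemma commute_imp_complex_on:
  assumes "w \<in> S2" "x * w = w * x"
  obtains z where "x = complex_on w z"
proof
  have r: "qre w = 0" and n: "qi w * qi w + qj w * qj w + qk w * qk w = 1"
    using assms(1) norm_quat_sq[of w] by (simp_all add: S2_iff power2_eq_square)
  have e: "qj x * qk w = qk x * qj w" "qk x * qi w = qi x * qk w" "qi x * qj w = qj x * qi w"
    using assms(2) r by (simp_all add: quat_eq_iff mult.commute)
  \<comment> \<open>The coefficient of \<open>x\<close> along the unit vector \<open>w\<close> is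
    \<open>inner x w\<close>; its sign is reversed to cancel the minus in
    \<open>complex_on\<close>.\<close>
  show "x = complex_on w (Complex (qre x) (- inner x w))"
    using r n e unfolding complex_on_def quat_eq_iff inner_quat_def
    by simp algebra
qed

section \<open>Multipliers and fixed points\<close>

text \<open>Matrices \<open>qmat A B\<close> are the biquaternions \<open>A + \<iota> B\<close> with central \<open>\<iota>\<close>. The multiplier
  is an automorphy factor for the action on \<open>S2\<close>: this is the cocycle property \<open>multiplier_mult\<close>.\<close>

definition multiplier :: "quat^2^2 \<Rightarrow> quat \<Rightarrow> quat" where
  "multiplier M u = M $ 1 $ 1 - M $ 1 $ 2 * u"

lemma qmat_nth [simp]:
  "qmat A B $ 1 $ 1 = A" "qmat A B $ 1 $ 2 = B" "qmat A B $ 2 $ 1 = - B" "qmat A B $ 2 $ 2 = A"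
  by (simp_all add: qmat_def)

lemma qmat_mult: "qmat A B ** qmat C D = qmat (A * C - B * D) (A * D + B * C)"
  by (simp add: vec_eq_iff forall_2 matrix_matrix_mult_def sum_2 algebra_simps)

lemma multiplier_qmat [simp]: "multiplier (qmat A B) u = A - B * u"
  by (simp add: multiplier_def)

lemma multiplier_mult:
  assumes "u * u = - 1" "(C - D * u) * u = u' * (C - D * u)"
  shows "multiplier (qmat A B ** qmat C D) u = multiplier (qmat A B) u' * multiplier (qmat C D) u"
proof -
  \<comment> \<open>As \<open>u * u = - 1\<close>, right multiplication by \<open>u\<close> turns
    \<open>C - D * u\<close> into \<open>D + C * u\<close>, the other combination of entries that
    occurs in the product.\<close>
  have "D + C * u = u' * (C - D * u)"
    using assms by (simp add: left_diff_distrib mult.assoc add.commute)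
  then have "(A - B * u') * (C - D * u) = A * (C - D * u) - B * (D + C * u)"
    by (simp add: left_diff_distrib mult.assoc)
  then show ?thesis
    by (simp add: qmat_mult algebra_simps)
qed

section \<open>The complex determinant and its multiplicativity\<close>

lemma cdet_qmat: "cdet (qmat A B) = Complex ((norm B)\<^sup>2 - (norm A)\<^sup>2) (- 2 * inner A B)"
  by (simp add: cdet_def)

lemma inner_mult_same_left: "inner (a * x) (a * y) = (norm a)\<^sup>2 * inner x (y :: quat)"
  unfolding norm_quat_sq inner_quat_def quat_sel_simps by algebra

lemma inner_mult_same_right: "inner (x * a) (y * a) = (norm a)\<^sup>2 * inner x (y :: quat)"
  unfolding norm_quat_sq inner_quat_def quat_sel_simps by algebra

lemma inner_mult_swap: "inner (a * c) (b * d) + inner (a * d) (b * c) = 2 * inner a b * inner c (d :: quat)"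
  unfolding inner_quat_def quat_sel_simps by algebra

text \<open>Up to sign, \<open>cdet\<close> is the norm form of the biquaternion
  \<open>A + \<iota> B\<close>, that is, the complex bilinear extension of the squared norm. The
  norm form is multiplicative, which explains the minus sign.\<close>

lemma cdet_mult: "cdet (qmat A B ** qmat C D) = - cdet (qmat A B) * cdet (qmat C D)"
proof (rule complex_eqI)
  have norm2: "(norm (x + y))\<^sup>2 = (norm x)\<^sup>2 + (norm y)\<^sup>2 + 2 * inner x y"
    "(norm (x - y))\<^sup>2 = (norm x)\<^sup>2 + (norm y)\<^sup>2 - 2 * inner x y" for x y :: quat
    by (simp_all add: power2_norm_eq_inner algebra_simps inner_commute)
  show "Re (cdet (qmat A B ** qmat C D)) = Re (- cdet (qmat A B) * cdet (qmat C D))"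
    using inner_mult_swap[of A C B D]
    by (simp add: qmat_mult cdet_qmat norm2 norm_mult algebra_simps)
  show "Im (cdet (qmat A B ** qmat C D)) = Im (- cdet (qmat A B) * cdet (qmat C D))"
    by (simp add: qmat_mult cdet_qmat inner_mult_same_left
        inner_mult_same_right inner_commute algebra_simps)
qed

lemma cdet_T: "cdet (T v) = Complex (1 - (norm v)\<^sup>2) (- 2 * qre v)"
  by (simp add: T_def cdet_qmat inner_quat_def)

lemma cdet_T_eq_0_iff: "cdet (T v) = 0 \<longleftrightarrow> v \<in> S2"
proof -
  have "1 - (norm v)\<^sup>2 = 0 \<longleftrightarrow> norm v = 1"
    using abs_square_eq_1[of "norm v"] by auto
  then show ?thesis
    by (auto simp: cdet_T complex_eq_iff S2_iff)
qed

section \<open>Splitting off the vector part\<close>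

lemma qim_eq: "q = of_real (qre q) + qim q"
  by (simp add: quat_eq_iff qim_def)

lemma qre_qim [simp]: "qre (qim q) = 0"
  by (simp add: qim_def)

lemma vec_part_qmat [simp]: "vec_part (qmat A B) = qmat (qim A) (qim B)"
  by (simp add: vec_part_def vec_eq_iff forall_2) (simp add: qim_def quat_eq_iff)

lemma multiplier_vec_part:
  "multiplier (qmat A B) w
    = complex_on w (Complex (qre A) (qre B)) + multiplier (vec_part (qmat A B)) w"
  by (subst (1) qim_eq[of A], subst (1) qim_eq[of B]) (simp add: complex_on_def algebra_simps)

text \<open>The two multipliers differ by an element of the plane of \<open>w\<close>, which
  commutes with \<open>w\<close>; hence a matrix and its vector part have the same fixed
  points.\<close>

lemma multiplier_commute_vec_part_iff:
  "multiplier (qmat A B) w * w = w * multiplier (qmat A B) w \<longleftrightarrow>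
    multiplier (vec_part (qmat A B)) w * w = w * multiplier (vec_part (qmat A B)) w"
  using complex_on_commute[of w w "Complex (qre A) (qre B)"]
  unfolding multiplier_vec_part by (simp add: algebra_simps del: vec_part_qmat)

lemma cdet_vec_part:
  "cdet (qmat A B) = cdet (vec_part (qmat A B)) - (Complex (qre A) (qre B))\<^sup>2"
  unfolding vec_part_qmat cdet_qmat norm_quat_sq inner_quat_def
  by (simp add: complex_eq_iff qim_def power2_eq_square algebra_simps)

text \<open>A purely imaginary biquaternion squares to a scalar, here its determinant. At a fixed
  point the multiplier inherits this relation.\<close>

lemma multiplier_square:
  assumes "qre a = 0" "qre b = 0" and w: "w \<in> S2"
    and comm: "multiplier (qmat a b) w * w = w * multiplier (qmat a b) w"
  shows "multiplier (qmat a b) w * multiplier (qmat a b) w = complex_on w (cdet (qmat a b))"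
proof -
  define m where "m = multiplier (qmat a b) w"
  have m: "m = a - b * w"
    by (simp add: m_def)
  have ww: "w * w = - 1"
    using w by (rule S2_square)
  have "m * w = a * w + b"
    by (simp add: m left_diff_distrib mult.assoc ww)
  then have "w * m = a * w + b"
    using comm by (simp add: m_def)
  then have "b * w * m = b * a * w + b * b"
    by (simp add: mult.assoc distrib_left)
  moreover have "m * m = a * m - b * w * m"
    by (subst (1) m) (simp add: left_diff_distrib)
  ultimately have "m * m = a * a - b * b - (a * b + b * a) * w"
    by (simp add: m algebra_simps)
  moreover have "a * a - b * b = of_real ((norm b)\<^sup>2 - (norm a)\<^sup>2)"
    "a * b + b * a = of_real (- 2 * inner a b)"
    using assms(1,2) unfolding norm_quat_sq
    by (simp_all add: quat_eq_iff inner_quat_def power2_eq_square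
        del: of_real_mult of_real_diff of_real_minus of_real_power)
  ultimately show ?thesis
    by (simp add: m_def cdet_qmat complex_on_def)
qed

text \<open>The multiplier \<open>m\<close> of \<open>M\<close> at a fixed point is an eigenvalue of \<open>M\<close>, and \<open>- cdet M\<close> is the
  product of both eigenvalues; hence \<open>cdet (vec_part M)\<close> vanishes iff they coincide.\<close>

lemma cdet_vec_part_eq_0_iff:
  assumes w: "w \<in> S2"
    and comm: "multiplier (qmat A B) w * w = w * multiplier (qmat A B) w"
    and nz: "multiplier (qmat A B) w \<noteq> 0"
  shows "cdet (vec_part (qmat A B)) = 0 \<longleftrightarrow>
    multiplier (qmat A B) w * multiplier (qmat A B) w = - complex_on w (cdet (qmat A B))"
proof -
  define s where "s = complex_on w (Complex (qre A) (qre B))"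
  define r where "r = multiplier (vec_part (qmat A B)) w"
  have m: "multiplier (qmat A B) w = s + r"
    unfolding s_def r_def by (rule multiplier_vec_part)
  have rw: "r * w = w * r"
    using comm unfolding r_def multiplier_commute_vec_part_iff .
  then have rr: "r * r = complex_on w (cdet (vec_part (qmat A B)))"
    using w unfolding r_def vec_part_qmat by (intro multiplier_square) auto
  have rs: "r * s = s * r"
    using rw unfolding s_def by (rule complex_on_commute)
  have "complex_on w (cdet (qmat A B)) = r * r - s * s"
    unfolding cdet_vec_part complex_on_diff rr s_def power2_eq_square complex_on_mult[OF w] ..
  \<comment> \<open>The eigenvalues are \<open>s + r\<close> and \<open>s - r\<close>, with product
    \<open>- cdet\<close>; they coincide exactly when \<open>r\<close> vanishes.\<close>
  then have "(s + r) * (s + r) = - complex_on w (cdet (qmat A B)) + 2 * ((s + r) * r)"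
    by (simp add: algebra_simps rs mult_2)
  then have "(s + r) * (s + r) = - complex_on w (cdet (qmat A B)) \<longleftrightarrow> r = 0"
    using nz unfolding m by (simp add: mult_2 flip: scaleR_2)
  also have "\<dots> \<longleftrightarrow> cdet (vec_part (qmat A B)) = 0"
    using rr complex_on_eq_0_iff[OF w] by (metis mult_eq_0_iff)
  finally show ?thesis
    unfolding m by blast
qed

text \<open>For zero determinant the multiplier of the vector part has square zero at each fixed
  point \<open>x\<close>, which gives \<open>qim A = qim B * x\<close>. Two different
  \<open>x\<close> force \<open>qim B = 0\<close>, and then \<open>qim A = 0\<close>.\<close>

lemma two_fixed_imp_vec_part_nondegenerate:
  assumes "u \<in> S2" "w \<in> S2" "u \<noteq> w" "vec_part (qmat A B) \<noteq> 0"
    and "multiplier (qmat A B) u * u = u * multiplier (qmat A B) u"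
    and "multiplier (qmat A B) w * w = w * multiplier (qmat A B) w"
  shows "cdet (vec_part (qmat A B)) \<noteq> 0"
proof
  assume 0: "cdet (vec_part (qmat A B)) = 0"
  have *: "qim A = qim B * x"
    if "x \<in> S2" "multiplier (qmat A B) x * x = x * multiplier (qmat A B) x" for x
  proof -
    have "multiplier (qmat (qim A) (qim B)) x * multiplier (qmat (qim A) (qim B)) x
        = complex_on x (cdet (qmat (qim A) (qim B)))"
      using that multiplier_commute_vec_part_iff[of A B x]
      by (intro multiplier_square) (simp_all only: vec_part_qmat qre_qim)
    then show ?thesis
      using 0 by (simp add: complex_on_def)
  qed
  have "qim B * u = qim B * w"
    using *[of u] *[of w] assms by metis
  then have "qim B = 0"
    using \<open>u \<noteq> w\<close> by simp
  then show False
    using *[of u] assms by (simp add: vec_eq_iff forall_2)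
qed

text \<open>The multiplier at a fixed point corresponds to one of the two square roots of the
  determinant, and each root determines its fixed point by a linear equation.\<close>

lemma card_commuting_multiplier_imaginary:
  assumes ab: "qre a = 0" "qre b = 0" and nz: "cdet (qmat a b) \<noteq> 0" and b: "b \<noteq> 0"
  shows "card {w \<in> S2. multiplier (qmat a b) w * w = w * multiplier (qmat a b) w} = 2"
proof -
  define z where "z = csqrt (cdet (qmat a b))"
  have z2: "z\<^sup>2 = cdet (qmat a b)" and z0: "z \<noteq> 0"
    using nz by (simp_all add: z_def)
  \<comment> \<open>This solves \<open>a - b * w = complex_on w y\<close> for \<open>w\<close>. The
    inverted factor is nonzero because \<open>b\<close> is imaginary and nonzero.\<close>
  define f where "f y = inverse (b - of_real (Im y)) * (a - of_real (Re y))" for y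
  have bt: "b - of_real t \<noteq> 0" for t
  proof
    assume *: "b - of_real t = 0"
    then have "t = 0"
      using ab arg_cong[OF *, of qre] by simp
    then show False
      using * b by simp
  qed
  have f_iff: "a - b * w = complex_on w y \<longleftrightarrow> w = f y" for w y
  proof -
    have "a - b * w = complex_on w y \<longleftrightarrow> (b - of_real (Im y)) * w = a - of_real (Re y)"
      by (auto simp: complex_on_def algebra_simps)
    also have "\<dots> \<longleftrightarrow> w = f y"
      unfolding f_def using bt[of "Im y"]
      by (metis left_inverse right_inverse mult.assoc mult_1_left)
    finally show ?thesis .
  qed
  \<comment> \<open>The real and imaginary parts of the equation for \<open>y\<^sup>2\<close> are
    the equality of norms and the orthogonality that put the quotient on the sphere.\<close>
  have f_S2: "f y \<in> S2" if y: "y\<^sup>2 = cdet (qmat a b)" for y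
    unfolding f_def
  proof (rule inverse_mult_in_S2[OF bt])
    have re: "(Re y)\<^sup>2 - (Im y)\<^sup>2 = (norm b)\<^sup>2 - (norm a)\<^sup>2"
      and im: "Re y * Im y = - inner a b"
      using arg_cong[OF y, of Re] arg_cong[OF y, of Im] by (simp_all add: cdet_qmat power2_eq_square mult.commute)
    have "(norm (b - of_real (Im y)))\<^sup>2 = (norm (a - of_real (Re y)))\<^sup>2"
      using re ab by (simp add: norm_quat_sq)
    then show "norm (b - of_real (Im y)) = norm (a - of_real (Re y))"
      by simp
    show "inner (b - of_real (Im y)) (a - of_real (Re y)) = 0"
      using im ab by (simp add: inner_quat_def algebra_simps)
  qed
  have "w \<in> S2 \<and> multiplier (qmat a b) w * w = w * multiplier (qmat a b) w \<longleftrightarrow>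
      w = f z \<or> w = f (- z)" for w
  proof
    assume w: "w \<in> S2 \<and> multiplier (qmat a b) w * w = w * multiplier (qmat a b) w"
    then obtain y where y: "multiplier (qmat a b) w = complex_on w y"
      using commute_imp_complex_on by blast
    then have "complex_on w (y * y) = complex_on w (z * z)"
      using multiplier_square[of a b w] w ab z2 by (simp add: complex_on_mult power2_eq_square)
    then have "y = z \<or> y = - z"
      using w by (simp add: complex_on_eq_iff square_eq_iff)
    then show "w = f z \<or> w = f (- z)"
      using y f_iff by auto
  next
    assume "w = f z \<or> w = f (- z)"
    then obtain y where y: "y\<^sup>2 = cdet (qmat a b)" "w = f y"
      using z2 by (metis power2_minus)
    then show "w \<in> S2 \<and> multiplier (qmat a b) w * w = w * multiplier (qmat a b) w"
      using f_S2[OF y(1)] f_iff[of w y] complex_on_commute[of w w y] by simp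
  qed
  moreover have "f z \<noteq> f (- z)"
  proof
    assume "f z = f (- z)"
    then have "complex_on (f z) z = complex_on (f z) (- z)"
      using f_iff[of "f z" z] f_iff[of "f z" "- z"] by simp
    then show False
      using f_S2[OF z2] z0 by (simp add: complex_on_eq_iff)
  qed
  moreover from calculation
  have "{w \<in> S2. multiplier (qmat a b) w * w = w * multiplier (qmat a b) w} = {f z, f (- z)}"
    by blast
  ultimately show ?thesis
    by simp
qed

lemma card_commuting_multiplier:
  assumes "cdet (vec_part (qmat A B)) \<noteq> 0"
  shows "card {w \<in> S2. multiplier (qmat A B) w * w = w * multiplier (qmat A B) w} = 2"
proof -
  have "card {w \<in> S2. multiplier (qmat a b) w * w = w * multiplier (qmat a b) w} = 2"
    if ab: "qre a = 0" "qre b = 0" and nz: "cdet (qmat a b) \<noteq> 0" for a b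
  proof (cases "b = 0")
    case False
    then show ?thesis
      using card_commuting_multiplier_imaginary that by blast
  next
    text \<open>Multiplying \<open>M\<close> by the imaginary unit does not change its fixed points.\<close>
    case True
    have "card {w \<in> S2. multiplier (qmat 0 a) w * w = w * multiplier (qmat 0 a) w} = 2"
      using True that by (intro card_commuting_multiplier_imaginary) (auto simp: cdet_qmat complex_eq_iff)
    moreover have "a * w * w = w * (a * w) \<longleftrightarrow> a * w = w * a" if "w \<in> S2" for w
    proof -
      have "w \<noteq> 0"
        using that by (auto simp: S2_iff)
      then show ?thesis
        by (simp flip: mult.assoc)
    qed
    ultimately show ?thesis
      using True by (simp cong: conj_cong)
  qed
  then show ?thesis
    using assms unfolding multiplier_commute_vec_part_iff[of A B] vec_part_qmat by simp
qed

section \<open>Parallelogram evolution\<close>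

definition parallelogram :: "quat \<Rightarrow> quat \<Rightarrow> quat \<Rightarrow> quat \<Rightarrow> bool" where
  "parallelogram u v u' v' \<longleftrightarrow> u + v' = v + u' \<and> v' * u = u' * v"

text \<open>Inserting \<open>v' = v + u' - u\<close> into the product relation leaves
  \<open>u' * (v - u) = (v - u) * u\<close>. Thus the explicit evolution of the algorithm is the
  only solution of the Baecklund equations.\<close>

lemma parallelogram_iff:
  assumes "v \<noteq> u"
  shows "parallelogram u v u' v' \<longleftrightarrow>
    u' = (v - u) * u * inverse (v - u) \<and> v' = (v - u) * v * inverse (v - u)"
proof -
  have "parallelogram u v u' v' \<longleftrightarrow> u' * (v - u) = (v - u) * u \<and> v' * (v - u) = (v - u) * v"
  proof
    assume "parallelogram u v u' v'"
    then have v': "v' = v + u' - u" and e: "v' * u = u' * v"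
      by (auto simp: parallelogram_def algebra_simps)
    have "u' * v = v * u + u' * u - u * u"
      unfolding e[symmetric] by (simp add: v' algebra_simps)
    then show "u' * (v - u) = (v - u) * u \<and> v' * (v - u) = (v - u) * v"
      by (simp add: v' algebra_simps)
  next
    assume e: "u' * (v - u) = (v - u) * u \<and> v' * (v - u) = (v - u) * v"
    then have "(v' - u') * (v - u) = (v - u) * v - (v - u) * u"
      by (simp only: left_diff_distrib[of v' u'])
    then have "(v' - u') * (v - u) = (v - u) * (v - u)"
      by (simp only: right_diff_distrib)
    then have "v' - u' = v - u"
      using assms by simp
    then have v': "v' = v + u' - u"
      by (simp add: algebra_simps)
    have "v' * u = u' * v"
      using e unfolding v' by (simp add: algebra_simps)
    then show "parallelogram u v u' v'"
      by (simp add: parallelogram_def v')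
  qed
  then show ?thesis
    using assms by (simp add: conj_eq_iff)
qed

text \<open>Walking backwards changes the sign of the edges and exchanges \<open>v\<close> and
  \<open>v'\<close>; the product relation survives because \<open>u\<close> and \<open>u'\<close>
  have the same square.\<close>

lemma parallelogram_reverse:
  assumes "parallelogram u v u' v'" "u \<in> S2" "u' \<in> S2"
  shows "parallelogram (- u) v' (- u') v"
proof -
  have v': "v' = v + u' - u" and e: "v' * u = u' * v"
    using assms(1) by (auto simp: parallelogram_def algebra_simps)
  have "u' * v' = v' * u - 1 - u' * u"
    unfolding e by (simp add: v' algebra_simps S2_square[OF assms(3)])
  also have "\<dots> = v * u"
    by (simp add: v' algebra_simps S2_square[OF assms(2)])
  finally show ?thesis
    by (simp add: parallelogram_def v')
qed

lemma qre_mult_commute: "qre (x * y) = qre (y * x)"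
  by simp

lemma qre_conj: "c \<noteq> 0 \<Longrightarrow> qre (c * x * inverse c) = qre x"
  using qre_mult_commute[of "c * x" "inverse c"] by (simp only: flip: mult.assoc) simp

context
  fixes n :: nat and v :: "nat \<Rightarrow> quat" and w :: quat
  assumes v: "\<And>l. l < n \<Longrightarrow> v l \<notin> S2" and w: "w \<in> S2"
begin

lemma evolve_u_in_S2: "l \<le> n \<Longrightarrow> evolve_u v w l \<in> S2"
proof (induction l)
  case (Suc l)
  then have "v l - evolve_u v w l \<noteq> 0"
    using v[of l] by auto
  then show ?case
    using Suc by simp
qed (simp add: w)

lemma evolve_diff_nonzero: "l < n \<Longrightarrow> v l - evolve_u v w l \<noteq> 0"
  using v[of l] evolve_u_in_S2[of l] by auto

lemma parallelogram_evolve: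
  "l < n \<Longrightarrow> parallelogram (evolve_u v w l) (v l) (evolve_u v w (Suc l)) (evolve_v v w l)"
  using evolve_diff_nonzero[of l] by (simp add: parallelogram_iff evolve_v_def)

lemma evolve_v_notin_S2: "l < n \<Longrightarrow> evolve_v v w l \<notin> S2"
  using evolve_diff_nonzero[of l] v[of l] by (simp add: evolve_v_def)

text \<open>Each parallelogram determines the next edge, so a chain is fixed by its first edge. This
  identifies given Baecklund transforms with the output of the evolution.\<close>

lemma evolve_unique:
  assumes p: "\<And>l. l < n \<Longrightarrow> parallelogram (p l) (v l) (p (Suc l)) (v' l)" and "p 0 = w"
  shows "l \<le> n \<Longrightarrow> p l = evolve_u v w l" and "l < n \<Longrightarrow> v' l = evolve_v v w l"
proof -
  show *: "p l = evolve_u v w l" if "l \<le> n" for l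
    using that
  proof (induction l)
    case (Suc l)
    then show ?case
      using p[of l] evolve_diff_nonzero[of l] by (simp add: parallelogram_iff)
  qed (simp add: assms)
  show "v' l = evolve_v v w l" if "l < n"
    using that p[of l] *[of l] evolve_diff_nonzero[of l] by (simp add: parallelogram_iff evolve_v_def)
qed

text \<open>\<open>cdet (T v)\<close> depends only on norm and real part, both invariant under
  conjugation.\<close>

lemma cdet_T_evolve_v: "l < n \<Longrightarrow> cdet (T (evolve_v v w l)) = cdet (T (v l))"
  using evolve_diff_nonzero[of l]
  unfolding cdet_T evolve_v_def by (subst qre_conj) (simp_all add: norm_mult norm_inverse)

end

text \<open>The reversed parallelograms form a chain starting at \<open>- w\<close>, and such a
  chain is unique.\<close>

lemma evolve_u_reverse:
  assumes "\<And>l. l < n \<Longrightarrow> v l \<notin> S2" "w \<in> S2"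
    and "l \<le> n"
  shows "evolve_u (evolve_v v w) (- w) l = - evolve_u v w l"
proof -
  have "parallelogram (- evolve_u v w l) (evolve_v v w l) (- evolve_u v w (Suc l)) (v l)"
    if "l < n" for l
    using that assms parallelogram_evolve[of n v w l] evolve_u_in_S2[of n v w]
    by (intro parallelogram_reverse) (auto simp del: evolve_u.simps)
  from evolve_unique(1)[of n "evolve_v v w" "- w" "\<lambda>l. - evolve_u v w l" v, OF _ _ this]
  show ?thesis
    using assms evolve_v_notin_S2[of n v w] by simp
qed

section \<open>Products of the matrices \<open>T\<close> and the monodromy\<close>

lemma T_prod_qmat: "\<exists>A B. T_prod v n = qmat A B"
proof (induction n)
  case 0
  have "T_prod v 0 = qmat 1 0"
    by (simp add: vec_eq_iff forall_2 mat_def)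
  then show ?case
    by blast
next
  case (Suc n)
  then show ?case
    by (metis T_def T_prod.simps(2) qmat_mult)
qed

lemma T_prod_cong: "(\<And>l. l < n \<Longrightarrow> v l = v' l) \<Longrightarrow> T_prod v n = T_prod v' n"
  by (induction n) auto

lemma cdet_T_prod_cong:
  "(\<And>l. l < n \<Longrightarrow> cdet (T (v l)) = cdet (T (v' l))) \<Longrightarrow> cdet (T_prod v n) = cdet (T_prod v' n)"
proof (induction n)
  case (Suc n)
  obtain A B C D where "T_prod v n = qmat A B" "T_prod v' n = qmat C D"
    using T_prod_qmat by meson
  then show ?case
    using Suc by (simp add: T_def cdet_mult)
qed simp

lemma cdet_T_prod_nonzero:
  "(\<And>l. l < n \<Longrightarrow> v l \<notin> S2) \<Longrightarrow> cdet (T_prod v n) \<noteq> 0"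
proof (induction n)
  case 0
  then show ?case
    by (simp add: cdet_def mat_def complex_eq_iff)
next
  case (Suc n)
  obtain A B where "T_prod v n = qmat A B"
    using T_prod_qmat by blast
  then show ?case
    using Suc cdet_T_eq_0_iff[of "v n"] by (simp add: T_def cdet_mult)
qed

text \<open>By the cocycle property the multiplier is the product of the factors
  \<open>v l - evolve_u v w l\<close>, and conjugation by it performs the evolution steps one after
  another.\<close>

lemma multiplier_T_prod:
  assumes "\<And>l. l < n \<Longrightarrow> v l \<notin> S2" and w: "w \<in> S2"
  shows "l \<le> n \<Longrightarrow> multiplier (T_prod v l) w \<noteq> 0 \<and>
    multiplier (T_prod v l) w * w = evolve_u v w l * multiplier (T_prod v l) w"
proof (induction l)
  case 0
  then show ?case
    by (simp add: multiplier_def mat_def)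
next
  case (Suc l)
  obtain A B where AB: "T_prod v l = qmat A B"
    using T_prod_qmat by blast
  let ?c = "v l - evolve_u v w l"
  have c: "?c \<noteq> 0"
    using evolve_diff_nonzero[of n v w l] assms Suc by simp
  have IH: "A - B * w \<noteq> 0" "(A - B * w) * w = evolve_u v w l * (A - B * w)"
    using Suc AB by simp_all
  have m: "multiplier (T_prod v (Suc l)) w = ?c * (A - B * w)"
    using multiplier_mult[OF S2_square[OF w] IH(2), of "v l" 1] by (simp add: T_def AB)
  have "evolve_u v w (Suc l) * ?c = ?c * evolve_u v w l"
    using evolve_u.simps(2)[of v w l] unfolding conj_eq_iff[OF c] .
  then have "evolve_u v w (Suc l) * ?c * (A - B * w) = ?c * (A - B * w) * w"
    using IH(2) by (simp only: mult.assoc)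
  then show ?case
    unfolding m using c IH(1) by (simp only: mult.assoc mult_eq_0_iff simp_thms)
qed

text \<open>The zero curvature relation of each parallelogram moves the edge matrix past one
  factor.\<close>

lemma T_prod_intertwine:
  "(\<And>l. l < n \<Longrightarrow> parallelogram (p l) (v l) (p (Suc l)) (v' l)) \<Longrightarrow>
    T_prod v' n ** T (p 0) = T (p n) ** T_prod v n"
proof (induction n)
  case (Suc n)
  have "T (v' n) ** T (p n) = T (p (Suc n)) ** T (v n)"
    using Suc.prems[of n] by (simp add: T_def qmat_mult parallelogram_def add.commute)
  moreover have "T_prod v' n ** T (p 0) = T (p n) ** T_prod v n"
    using Suc by simp
  ultimately show ?case
    by (simp flip: matrix_mul_assoc) (simp add: matrix_mul_assoc)
qed simp

lemma monodromy_qmat: "\<exists>A B. monodromy n E v = qmat A B"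
  unfolding monodromy_def using T_prod_qmat[of v n] qmat_mult by metis

lemma monodromy_cong: "(\<And>l. l < n \<Longrightarrow> v l = v' l) \<Longrightarrow> monodromy n E v = monodromy n E v'"
  unfolding monodromy_def using T_prod_cong[of n v v'] by simp

lemma evolve_u_cong: "(\<And>l. l < n \<Longrightarrow> v l = v' l) \<Longrightarrow> l \<le> n \<Longrightarrow> evolve_u v w l = evolve_u v' w l"
  by (induction l) auto

lemma admissible_cong: "(\<And>l. l < n \<Longrightarrow> v l = v' l) \<Longrightarrow> admissible n E v \<longleftrightarrow> admissible n E v'"
  using monodromy_cong[of n v v' E] by (simp add: admissible_def)

text \<open>The closing condition lets the edge matrix pass through \<open>E\<close> as well,
  turning \<open>p n\<close> back into \<open>p 0\<close>.\<close>

lemma monodromy_intertwine: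
  assumes "\<And>l. l < n \<Longrightarrow> parallelogram (p l) (v l) (p (Suc l)) (v' l)"
    and "E \<noteq> 0" "p 0 = E * p n * inverse E"
  shows "monodromy n E v' ** T (p 0) = T (p 0) ** monodromy n E v"
proof -
  have "qmat E 0 ** T (p n) = T (p 0) ** qmat E 0"
    using assms conj_eq_iff[of E "p 0" "p n"] by (simp add: T_def qmat_mult)
  then show ?thesis
    using T_prod_intertwine[of n p v v', OF assms(1)]
    unfolding monodromy_def by (metis matrix_mul_assoc)
qed

context
  fixes n :: nat and v :: "nat \<Rightarrow> quat" and E :: quat
  assumes v: "\<And>l. l < n \<Longrightarrow> v l \<notin> S2" and E: "E \<noteq> 0"
begin

lemma cdet_monodromy_nonzero: "cdet (monodromy n E v) \<noteq> 0"
proof -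
  obtain A B where "T_prod v n = qmat A B"
    using T_prod_qmat by blast
  then have "cdet (qmat A B) \<noteq> 0"
    using cdet_T_prod_nonzero[of n v] v by simp
  moreover have "cdet (qmat E 0) \<noteq> 0"
    using E by (simp add: cdet_qmat complex_eq_iff)
  ultimately show ?thesis
    by (simp add: monodromy_def cdet_mult \<open>T_prod v n = qmat A B\<close>)
qed

lemma multiplier_monodromy:
  assumes "w \<in> S2"
  shows "multiplier (monodromy n E v) w \<noteq> 0"
    and "act (monodromy n E v) w = E * evolve_u v w n * inverse E"
proof -
  obtain A B where AB: "T_prod v n = qmat A B"
    using T_prod_qmat by blast
  have m: "A - B * w \<noteq> 0" "(A - B * w) * w = evolve_u v w n * (A - B * w)"
    using multiplier_T_prod[of n v w n] v assms AB by auto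
  have eq: "multiplier (monodromy n E v) w = E * (A - B * w)"
    by (simp add: monodromy_def AB qmat_mult algebra_simps)
  then show "multiplier (monodromy n E v) w \<noteq> 0"
    using m E by simp
  have "act (monodromy n E v) w = E * (A - B * w) * w * inverse (E * (A - B * w))"
    using eq by (simp add: act_def multiplier_def)
  also have "\<dots> = E * ((A - B * w) * w) * (inverse (A - B * w) * inverse E)"
    using m E by (simp add: nonzero_inverse_mult_distrib mult.assoc)
  also have "\<dots> = E * evolve_u v w n * ((A - B * w) * inverse (A - B * w)) * inverse E"
    unfolding m(2) by (simp only: mult.assoc)
  also have "\<dots> = E * evolve_u v w n * inverse E"
    using m(1) by simp
  finally show "act (monodromy n E v) w = E * evolve_u v w n * inverse E" .
qed

text \<open>The monodromy acts by evolving an edge through all \<open>n\<close> transforms and then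
  rotating by \<open>E\<close>.\<close>

lemma fixed_point_iff_evolve:
  "fixed_point (monodromy n E v) w \<longleftrightarrow> w \<in> S2 \<and> w = E * evolve_u v w n * inverse E"
  using cdet_monodromy_nonzero multiplier_monodromy(2)[of w] unfolding fixed_point_def by auto

lemma fixed_point_iff_commute:
  "fixed_point (monodromy n E v) w \<longleftrightarrow>
    w \<in> S2 \<and> multiplier (monodromy n E v) w * w = w * multiplier (monodromy n E v) w"
proof (cases "w \<in> S2")
  case True
  let ?m = "multiplier (monodromy n E v) w"
  have "act (monodromy n E v) w = ?m * w * inverse ?m"
    by (simp add: act_def multiplier_def Let_def)
  then have "act (monodromy n E v) w = w \<longleftrightarrow> w = ?m * w * inverse ?m"
    by auto
  then show ?thesis
    using True cdet_monodromy_nonzero conj_eq_iff[OF multiplier_monodromy(1)[OF True], of w w]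
    unfolding fixed_point_def by auto
qed (simp add: fixed_point_def)

lemma card_fixed_points:
  assumes "cdet (vec_part (monodromy n E v)) \<noteq> 0"
  shows "card {w. fixed_point (monodromy n E v) w} = 2"
proof -
  obtain A B where "monodromy n E v = qmat A B"
    using monodromy_qmat by blast
  then show ?thesis
    using card_commuting_multiplier[of A B] assms unfolding fixed_point_iff_commute by simp
qed

lemma admissible_if_two_fixed_points:
  assumes "fixed_point (monodromy n E v) u" "fixed_point (monodromy n E v) w" "u \<noteq> w"
    and "vec_part (monodromy n E v) \<noteq> 0"
  shows "admissible n E v"
proof -
  obtain A B where "monodromy n E v = qmat A B"
    using monodromy_qmat by blast
  then have "cdet (vec_part (monodromy n E v)) \<noteq> 0"
    using two_fixed_imp_vec_part_nondegenerate[of u w A B] assms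
    unfolding fixed_point_iff_commute by metis
  then show ?thesis
    using v E by (simp add: admissible_def)
qed

end

lemma fixed_point_uminus_evolve:
  assumes "\<And>l. l < n \<Longrightarrow> v l \<notin> S2" "E \<noteq> 0" "fixed_point (monodromy n E v) w"
  shows "fixed_point (monodromy n E (evolve_v v w)) (- w)"
proof -
  have w: "w \<in> S2" "w = E * evolve_u v w n * inverse E"
    using assms fixed_point_iff_evolve[of n v E w] by auto
  have "- w = E * evolve_u (evolve_v v w) (- w) n * inverse E"
    using evolve_u_reverse[of n v w n] assms w by simp
  then show ?thesis
    using w(1) assms evolve_v_notin_S2[of n v w] by (simp add: fixed_point_iff_evolve)
qed

text \<open>The multiplier of \<open>M(i + 1)\<close> at \<open>- u(i)\<close> is conjugate to that of \<open>M(i)\<close> at the fixed point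
  other than \<open>u(i)\<close>: evolution preserves the eigenvalues of \<open>M(i)\<close>.\<close>

lemma admissible_evolve:
  assumes adm: "admissible n E v" and w: "fixed_point (monodromy n E v) w"
  shows "admissible n E (evolve_v v w)"
proof -
  define v' where "v' = evolve_v v w"
  have v: "\<And>l. l < n \<Longrightarrow> v l \<notin> S2" and E: "E \<noteq> 0"
    and nz: "cdet (vec_part (monodromy n E v)) \<noteq> 0"
    using adm by (auto simp: admissible_def)
  have wS: "w \<in> S2" and wE: "w = E * evolve_u v w n * inverse E"
    using w fixed_point_iff_evolve[OF v E] by auto
  have v': "\<And>l. l < n \<Longrightarrow> v' l \<notin> S2"
    using evolve_v_notin_S2[OF v wS] by (simp add: v'_def)
  have "card {x. fixed_point (monodromy n E v) x} = 2"
    by (rule card_fixed_points[OF v E nz])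
  then obtain x where x: "fixed_point (monodromy n E v) x" "x \<noteq> w"
    by (metis (mono_tags, lifting) card_2_iff insertCI mem_Collect_eq)
  then have xS: "x \<in> S2"
    by (simp add: fixed_point_def)
  obtain A B where AB: "monodromy n E v = qmat A B"
    using monodromy_qmat by blast
  obtain A' B' where AB': "monodromy n E v' = qmat A' B'"
    using monodromy_qmat by blast
  let ?m = "multiplier (qmat A B) x" and ?m' = "multiplier (qmat A' B') (- w)"
  have mx: "?m * x = x * ?m" "?m \<noteq> 0"
    using x(1) fixed_point_iff_commute[of n v E x, OF v E]
      multiplier_monodromy(1)[of n v E x, OF v E xS] AB by auto
  have "fixed_point (monodromy n E v') (- w)"
    unfolding v'_def by (rule fixed_point_uminus_evolve[OF v E w])
  then have mw: "?m' * (- w) = - w * ?m'" "?m' \<noteq> 0"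
    using fixed_point_iff_commute[of n v' E "- w", OF v' E]
      multiplier_monodromy(1)[of n v' E "- w", OF v' E] AB' wS
    by auto
  \<comment> \<open>This is the multiplier of \<open>T w\<close> at \<open>x\<close>. From
    \<open>w * w = x * x\<close> it follows that \<open>T w\<close> moves \<open>x\<close> to
    \<open>- w\<close>, and \<open>x \<noteq> w\<close> makes the multiplier invertible.\<close>
  define c where "c = w - x"
  have c: "c \<noteq> 0" and cx: "c * x = - w * c"
    using x(2) by (simp_all add: c_def algebra_simps S2_square[OF xS] S2_square[OF wS])
  have "qmat A' B' ** T w = T w ** qmat A B"
    using monodromy_intertwine[of n "evolve_u v w" v v' E] parallelogram_evolve[of n v w, OF v wS] wE E
    by (simp add: v'_def AB AB'[unfolded v'_def] del: evolve_u.simps(2))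
  moreover have "multiplier (qmat A' B' ** T w) x = ?m' * c"
    using multiplier_mult[of x w 1 "- w" A' B'] cx by (simp add: T_def c_def S2_square[OF xS])
  moreover have "multiplier (T w ** qmat A B) x = c * ?m"
    using multiplier_mult[of x A B x w 1] mx by (simp add: T_def c_def S2_square[OF xS])
  \<comment> \<open>Both sides of the intertwining relation are evaluated at
    \<open>x\<close>.\<close>
  ultimately have cm: "?m' * c = c * ?m"
    by simp
  have "cdet (T_prod v' n) = cdet (T_prod v n)"
    unfolding v'_def by (rule cdet_T_prod_cong) (rule cdet_T_evolve_v[OF v wS])
  then have D: "cdet (qmat A' B') = cdet (qmat A B)"
    using T_prod_qmat[of v n] T_prod_qmat[of v' n] unfolding AB[symmetric] AB'[symmetric] monodromy_def
    by (auto simp: cdet_mult)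
  \<comment> \<open>Conjugation by \<open>c\<close> carries the criterion for coinciding eigenvalues
    from \<open>x\<close> to \<open>- w\<close>; the determinants agree by \<open>D\<close>.\<close>
  have "?m' * ?m' * c = c * (?m * ?m)"
    using cm by (metis mult.assoc)
  moreover have "c * complex_on x z = complex_on (- w) z * c" for z
    by (rule complex_on_conj) (rule cx)
  ultimately have "?m' * ?m' = - complex_on (- w) (cdet (qmat A' B')) \<longleftrightarrow>
      ?m * ?m = - complex_on x (cdet (qmat A B))"
    using c D by (metis mult_left_cancel mult_right_cancel mult_minus_left mult_minus_right)
  then have "cdet (vec_part (qmat A' B')) = 0 \<longleftrightarrow> cdet (vec_part (qmat A B)) = 0"
    using cdet_vec_part_eq_0_iff[OF xS mx] cdet_vec_part_eq_0_iff[OF _ mw] wS by simp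
  then show ?thesis
    using nz v' E unfolding admissible_def v'_def[symmetric] by (simp add: AB AB')
qed

section \<open>Runs and invariant curves\<close>

lemma card_fixed_points_admissible:
  "admissible n E v \<Longrightarrow> card {w. fixed_point (monodromy n E v) w} = 2"
  by (rule card_fixed_points) (auto simp: admissible_def)

lemma unique_next_edge:
  assumes "admissible n E v" "fixed_point (monodromy n E v) w"
  shows "\<exists>!y. fixed_point (monodromy n E (evolve_v v w)) y \<and> y \<noteq> - w"
proof -
  have "card {y. fixed_point (monodromy n E (evolve_v v w)) y} = 2"
    using assms by (intro card_fixed_points_admissible admissible_evolve)
  moreover have "- w \<in> {y. fixed_point (monodromy n E (evolve_v v w)) y}"
    using assms fixed_point_uminus_evolve[of n v E w] by (simp add: admissible_def)
  ultimately obtain y where "{y. fixed_point (monodromy n E (evolve_v v w)) y} = {- w, y}" "y \<noteq> - w"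
    unfolding card_2_iff by (metis insertE insert_commute singletonD)
  then show ?thesis
    by blast
qed

lemma run_upto_admissible:
  assumes "admissible n E v0" "run_upto n E v0 N u v"
  shows "i \<le> N \<Longrightarrow> admissible n E (v i)"
proof (induction i)
  case 0
  then show ?case
    using assms admissible_cong[of n "v 0" v0 E] by (simp add: run_upto_def)
next
  case (Suc i)
  then have "admissible n E (evolve_v (v i) (u i))"
    using assms(2) by (intro admissible_evolve) (auto simp: run_upto_def edge_choice_def)
  then show ?case
    using Suc assms admissible_cong[of n "v (Suc i)" "evolve_v (v i) (u i)" E]
    by (simp add: run_upto_def)
qed

lemma run_iff:
  "run n E v0 u v \<longleftrightarrow> (\<forall>l<n. v 0 l = v0 l) \<and>
    (\<forall>i. edge_choice n E u v i (u i) \<and> (\<forall>l<n. v (Suc i) l = evolve_v (v i) (u i) l))"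
  unfolding run_def run_upto_def by (meson lessI)

lemma runD:
  assumes "admissible n E v0" "run n E v0 u v"
  shows "admissible n E (v i)" "fixed_point (monodromy n E (v i)) (u i)" "u (Suc i) \<noteq> - u i"
    "l < n \<Longrightarrow> v 0 l = v0 l" "l < n \<Longrightarrow> v (Suc i) l = evolve_v (v i) (u i) l"
proof -
  show "admissible n E (v i)"
    using run_upto_admissible[OF assms(1), of i u v i] assms(2) by (simp add: run_def)
  show "fixed_point (monodromy n E (v i)) (u i)" "l < n \<Longrightarrow> v 0 l = v0 l"
    "l < n \<Longrightarrow> v (Suc i) l = evolve_v (v i) (u i) l"
    using assms(2) by (simp_all add: run_iff edge_choice_def)
  have "edge_choice n E u v (Suc i) (u (Suc i))"
    using assms(2) unfolding run_iff by blast
  then show "u (Suc i) \<noteq> - u i"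
    by (simp add: edge_choice_def)
qed

text \<open>Dependent choice over pairs of an edge and a row of \<open>v\<close>: admissibility
  travels with the state, so a next edge is always available.\<close>

lemma run_exists:
  assumes "admissible n E v0" "fixed_point (monodromy n E v0) w"
  shows "\<exists>u v. run n E v0 u v \<and> u 0 = w"
proof -
  let ?P = "\<lambda>i x. admissible n E (snd x) \<and> fixed_point (monodromy n E (snd x)) (fst x) \<and>
    (i = (0::nat) \<longrightarrow> x = (w, v0))"
  let ?Q = "\<lambda>_ x y. snd y = evolve_v (snd x) (fst x) \<and> fst y \<noteq> - fst x"
  have "\<exists>f. \<forall>i. ?P i (f i) \<and> ?Q i (f i) (f (Suc i))"
  proof (rule dependent_nat_choice)
    show "\<exists>x. ?P 0 x"
      using assms by auto
    fix x i
    assume x: "?P i x"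
    obtain y where "fixed_point (monodromy n E (evolve_v (snd x) (fst x))) y" "y \<noteq> - fst x"
      using x unique_next_edge[of n E "snd x" "fst x"] by blast
    then show "\<exists>y. ?P (Suc i) y \<and> ?Q i x y"
      using x admissible_evolve[of n E "snd x" "fst x"]
      by (intro exI[of _ "(y, evolve_v (snd x) (fst x))"]) auto
  qed
  then obtain f where f: "\<And>i. ?P i (f i)" "\<And>i. ?Q i (f i) (f (Suc i))"
    by blast
  \<comment> \<open>For \<open>i = 0\<close> the truncated predecessor is harmless, as the exclusion
    of the reversed edge applies to positive \<open>i\<close> only.\<close>
  have "edge_choice n E (fst \<circ> f) (snd \<circ> f) i ((fst \<circ> f) i)" for i
    using f(1)[of i] f(2)[of "i - 1"] by (auto simp: edge_choice_def)
  then have "run n E v0 (fst \<circ> f) (snd \<circ> f)"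
    using f(1)[of 0] f(2) by (simp add: run_iff)
  then show ?thesis
    using f(1)[of 0] by (intro exI[of _ "fst \<circ> f"] exI[of _ "snd \<circ> f"]) simp
qed

section \<open>Curves with prescribed edges\<close>

lemma discrete_curve_with_edges:
  assumes "\<And>k. qre (e k) = 0"
  shows "\<exists>\<gamma>. discrete_curve \<gamma> \<and> (\<forall>k. edge \<gamma> k = e k)"
proof -
  \<comment> \<open>One of the two sums is always empty; the curve starts at the origin.\<close>
  define \<gamma> where "\<gamma> k = sum e {0..<k} - sum e {k..<0}" for k :: int
  have "qre (sum e A) = 0" for A
    using assms by (induction A rule: infinite_finite_induct) auto
  then have "discrete_curve \<gamma>"
    by (simp add: discrete_curve_def \<gamma>_def Im_quat_def)
  moreover have "edge \<gamma> k = e k" for k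
  proof (cases "k \<ge> 0")
    case True
    then have "{0..<k + 1} = insert k {0..<k}"
      by auto
    then show ?thesis
      using True by (simp add: edge_def \<gamma>_def)
  next
    case False
    then have "{k..<0} = insert k {k + 1..<0}"
      by auto
    then show ?thesis
      using False by (simp add: edge_def \<gamma>_def)
  qed
  ultimately show ?thesis
    by blast
qed

text \<open>The second case has the index shift of the backward run: its edge number
  \<open>i\<close> is, up to sign, the edge joining the vertices \<open>- i - 1\<close> and
  \<open>- i\<close>.\<close>

lemma int_cases_edge:
  obtains i where "k = int i" | i where "k = - int i - 1"
  by (metis int_cases add.commute minus_add_distrib of_nat_Suc uminus_add_conv_diff)

lemma curve_of_run_exists:
  assumes adm: "admissible n E v0" and r: "run n E v0 u v"
  shows "\<exists>\<gamma>. curve_of_run n E v0 u \<gamma>"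
proof -
  obtain x where x: "fixed_point (monodromy n E v0) x" "x \<noteq> u 0"
    using card_fixed_points_admissible[OF adm]
    by (metis (mono_tags, lifting) card_2_iff insertCI mem_Collect_eq)
  then obtain u' v' where r': "run n E v0 u' v'" "u' 0 = x"
    using run_exists[OF adm] by blast
  define e where "e k = (if k \<ge> 0 then u (nat k) else - u' (nat (- k - 1)))" for k :: int
  have "qre (u i) = 0" "qre (u' i) = 0" for i
    using runD(2)[OF adm r] runD(2)[OF adm r'(1)] by (simp_all add: fixed_point_def S2_iff)
  then have "qre (e k) = 0" for k
    by (simp add: e_def)
  then obtain \<gamma> where "discrete_curve \<gamma>" "\<forall>k. edge \<gamma> k = e k"
    using discrete_curve_with_edges by blast
  then have "curve_of_run n E v0 u \<gamma>"
    using r' x unfolding curve_of_run_def by (auto simp: e_def)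
  then show ?thesis
    by blast
qed

lemma norm_edge_eq_1_iff:
  "discrete_curve \<gamma> \<Longrightarrow> norm (edge \<gamma> k) = 1 \<longleftrightarrow> edge \<gamma> k \<in> S2"
  by (simp add: S2_iff edge_def discrete_curve_def Im_quat_def)

lemma regular_curve_iff: "regular_curve \<gamma> \<longleftrightarrow> (\<forall>k. edge \<gamma> k \<noteq> - edge \<gamma> (k - 1))"
  by (simp add: regular_curve_def edge_def) (metis eq_iff_diff_eq_0 diff_add_cancel minus_diff_eq)

lemma baecklund_iff:
  "baecklund u v u' \<longleftrightarrow>
    (\<forall>k. v k \<notin> S2 \<and> u' k \<in> S2 \<and> parallelogram (u k) (v k) (u' k) (v (k + 1)))"
  by (auto simp: baecklund_def parallelogram_def)

text \<open>The forward run and the reversed backward run are glued at vertex \<open>0\<close>,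
  where both have the same initial data.\<close>

lemma curve_of_run_n_invariant:
  assumes adm: "admissible n E v0" and r: "run n E v0 u v" and c: "curve_of_run n E v0 u \<gamma>"
  shows "n_invariant n \<gamma>"
proof -
  obtain u' v' where r': "run n E v0 u' v'" and ne: "u' 0 \<noteq> u 0"
    and dc: "discrete_curve \<gamma>"
    and e: "\<And>i. edge \<gamma> (int i) = u i" "\<And>i. edge \<gamma> (- int i - 1) = - u' i"
    using c unfolding curve_of_run_def by blast
  note R = runD[OF adm r] and R' = runD[OF adm r']
  have E: "E \<noteq> 0"
    using adm by (simp add: admissible_def)
  have v: "v i l \<notin> S2" and v': "v' i l \<notin> S2" if "l < n" for i l
    using R(1)[of i] R'(1)[of i] that by (simp_all add: admissible_def)
  have u: "u i \<in> S2" "u i = E * evolve_u (v i) (u i) n * inverse E" for i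
    using R(2)[of i] fixed_point_iff_evolve[of n "v i" E "u i"] v E by auto
  have u': "u' i \<in> S2" "u' i = E * evolve_u (v' i) (u' i) n * inverse E" for i
    using R'(2)[of i] fixed_point_iff_evolve[of n "v' i" E "u' i"] v' E by auto
  define U where "U k l = (if k \<ge> 0 then evolve_u (v (nat k)) (u (nat k)) l
    else - evolve_u (v' (nat (- k - 1))) (u' (nat (- k - 1))) l)" for k l
  \<comment> \<open>Vertex \<open>- i\<close> carries row \<open>i\<close> of the backward run,
    without the shift by one that edges have.\<close>
  define V where "V k l = (if k \<ge> 0 then v (nat k) l else v' (nat (- k)) l)" for k :: int and l
  have U1: "U (int i) l = evolve_u (v i) (u i) l"
    and U2: "U (- int i - 1) l = - evolve_u (v' i) (u' i) l" for i l
    by (simp_all add: U_def)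
  have V1: "V (int i) = v i" for i
    by (simp add: V_def fun_eq_iff)
  \<comment> \<open>At \<open>i = 0\<close> the two runs share only the prescribed entries, hence
    the bound on \<open>l\<close>.\<close>
  have V2: "V (- int i) l = v' i l" if "l < n" for i l
    using R(4)[OF that] R'(4)[OF that] by (cases "i = 0") (simp_all add: V_def)
  have V3: "V (- int i - 1) = v' (Suc i)" for i
    by (simp add: V_def fun_eq_iff nat_add_distrib)
  have UE: "edge \<gamma> k = U k 0" for k
    by (rule int_cases_edge[of k]) (simp_all add: e U1 U2)
  have adm': "admissible n E (V k)" for k
    by (rule int_cases_edge[of k]) (simp_all add: V1 V3 R(1) R'(1))
  have US: "U k l \<in> S2" if "l \<le> n" for k l
    using evolve_u_in_S2[OF v u(1) that] evolve_u_in_S2[OF v' u'(1) that]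
    by (cases k rule: int_cases_edge) (simp_all add: U1 U2)
  have P: "parallelogram (U k l) (V k l) (U k (Suc l)) (V (k + 1) l)" if "l < n" for k l
  proof (rule int_cases_edge[of k])
    fix i
    assume k: "k = int i"
    have "V (k + 1) l = evolve_v (v i) (u i) l"
      using V1[of "Suc i"] R(5)[OF that] by (simp add: k add.commute)
    then show ?thesis
      using parallelogram_evolve[of n "v i" "u i" l] that v u(1)
      by (simp add: k U1 V1 del: evolve_u.simps)
  next
    fix i
    assume k: "k = - int i - 1"
    have "parallelogram (- evolve_u (v' i) (u' i) l) (evolve_v (v' i) (u' i) l)
        (- evolve_u (v' i) (u' i) (Suc l)) (v' i l)"
      using parallelogram_evolve[of n "v' i" "u' i" l] evolve_u_in_S2[of n "v' i" "u' i"] that v' u'(1)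
      by (intro parallelogram_reverse) (simp_all del: evolve_u.simps)
    then show ?thesis
      using V2[OF that, of i] R'(5)[OF that, of i] by (simp add: k U2 V3 del: evolve_u.simps)
  qed
  have "regular_curve \<gamma>"
    unfolding regular_curve_iff
  proof
    fix k
    show "edge \<gamma> k \<noteq> - edge \<gamma> (k - 1)"
    proof (rule int_cases_edge[of k])
      fix i
      assume k: "k = int i"
      show ?thesis
      proof (cases i)
        case 0
        then show ?thesis
          \<comment> \<open>Regularity at vertex \<open>0\<close> says that the two runs start with
            different fixed points.\<close>
          using e(1)[of 0] e(2)[of 0] ne by (simp add: k)
      next
        case (Suc j)
        then show ?thesis
          using e(1)[of i] e(1)[of j] R(3)[of j] by (simp add: k)
      qed
    next
      fix i
      assume k: "k = - int i - 1"
      then have "k - 1 = - int (Suc i) - 1"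
        by simp
      then show ?thesis
        using e(2)[of i] e(2)[of "Suc i"] R'(3)[of i] k by (metis minus_minus)
    qed
  qed
  moreover have "arc_length_parametrized \<gamma>"
    using US[of 0] by (simp add: arc_length_parametrized_def UE S2_iff)
  moreover have "\<forall>l<n. baecklund (\<lambda>k. U k l) (\<lambda>k. V k l) (\<lambda>k. U k (Suc l))"
    unfolding baecklund_iff using P US adm' by (simp add: admissible_def Suc_le_eq)
  moreover have "\<forall>k. U k 0 = E * U k n * inverse E"
  proof
    fix k
    show "U k 0 = E * U k n * inverse E"
      by (rule int_cases_edge[of k]) (use u(2) u'(2) in \<open>simp_all add: U1 U2\<close>)
  qed
  moreover have "\<forall>k. vec_part (monodromy n E (V k)) \<noteq> 0"
  proof
    fix k
    have "cdet 0 = 0"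
      by (simp add: cdet_def complex_eq_iff)
    then show "vec_part (monodromy n E (V k)) \<noteq> 0"
      using adm'[of k] by (auto simp: admissible_def)
  qed
  ultimately show ?thesis
    unfolding n_invariant_def using dc UE E
    by (intro conjI exI[of _ U] exI[of _ V] exI[of _ E]) auto
qed

text \<open>The rows of the given transforms, read from vertex \<open>0\<close> in both directions,
  are two runs: uniqueness of the evolution yields the recursion, and regularity yields the choice
  of fixed point.\<close>

lemma n_invariant_imp_curve_of_run:
  assumes "n_invariant n \<gamma>"
  shows "\<exists>E v0 u v. admissible n E v0 \<and> run n E v0 u v \<and> curve_of_run n E v0 u \<gamma>"
proof -
  obtain u v E where dc: "discrete_curve \<gamma>" and al: "arc_length_parametrized \<gamma>"
    and reg: "regular_curve \<gamma>" and u0: "\<And>k. edge \<gamma> k = u k 0"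
    and b: "\<And>l. l < n \<Longrightarrow> baecklund (\<lambda>k. u k l) (\<lambda>k. v k l) (\<lambda>k. u k (Suc l))"
    and E: "E \<noteq> 0" "\<And>k. u k 0 = E * u k n * inverse E"
    and vp: "\<And>k. vec_part (monodromy n E (v k)) \<noteq> 0"
    using assms unfolding n_invariant_def by metis
  have v: "v k l \<notin> S2" and P: "parallelogram (u k l) (v k l) (u k (Suc l)) (v (k + 1) l)"
    if "l < n" for k l
    using b[OF that] by (auto simp: baecklund_iff)
  have u: "u k l \<in> S2" if "l \<le> n" for k l
  proof (cases l)
    case 0
    then show ?thesis
      using al norm_edge_eq_1_iff[OF dc, of k] by (simp add: u0 arc_length_parametrized_def)
  next
    case (Suc l')
    then show ?thesis
      using b[of l'] that by (simp add: baecklund_iff)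
  qed
  have Q: "parallelogram (- u (k - 1) l) (v k l) (- u (k - 1) (Suc l)) (v (k - 1) l)"
    if "l < n" for k l
    using P[OF that, of "k - 1"] u[of l "k - 1"] u[of "Suc l" "k - 1"] that
    by (simp add: parallelogram_reverse)
  have fwd: "fixed_point (monodromy n E (v k)) (u k 0)"
    "l < n \<Longrightarrow> v (k + 1) l = evolve_v (v k) (u k 0) l" for k l
  proof -
    note * = evolve_unique[of n "v k" "u k 0" "u k" "v (k + 1)", OF v u[of 0] P refl]
    have "u k 0 = E * evolve_u (v k) (u k 0) n * inverse E"
      using *(1)[of n] E(2)[of k] by simp
    then show "fixed_point (monodromy n E (v k)) (u k 0)"
      using fixed_point_iff_evolve[of n "v k" E "u k 0", OF v E(1)] u[of 0 k] by blast
    show "l < n \<Longrightarrow> v (k + 1) l = evolve_v (v k) (u k 0) l"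
      using *(2)[of l] by simp
  qed
  have bwd: "fixed_point (monodromy n E (v k)) (- u (k - 1) 0)"
    "l < n \<Longrightarrow> v (k - 1) l = evolve_v (v k) (- u (k - 1) 0) l" for k l
  proof -
    have S: "- u (k - 1) 0 \<in> S2"
      using u[of 0 "k - 1"] by simp
    note * = evolve_unique[of n "v k" "- u (k - 1) 0" "\<lambda>l. - u (k - 1) l" "v (k - 1)",
        OF v S Q refl]
    have "evolve_u (v k) (- u (k - 1) 0) n = - u (k - 1) n"
      using *(1)[of n] by simp
    then have "- u (k - 1) 0 = E * evolve_u (v k) (- u (k - 1) 0) n * inverse E"
      using E(2)[of "k - 1"] by (metis mult_minus_left mult_minus_right)
    then show "fixed_point (monodromy n E (v k)) (- u (k - 1) 0)"
      using fixed_point_iff_evolve[of n "v k" E "- u (k - 1) 0", OF v E(1)] S by blast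
    show "l < n \<Longrightarrow> v (k - 1) l = evolve_v (v k) (- u (k - 1) 0) l"
      using *(2)[of l] by simp
  qed
  have ne: "u k 0 \<noteq> - u (k - 1) 0" for k
    using reg by (simp add: regular_curve_iff u0)
  \<comment> \<open>Regularity at vertex \<open>0\<close> makes \<open>u 0 0\<close> and
    \<open>- u (- 1) 0\<close> different fixed points of the same monodromy.\<close>
  have "admissible n E (v 0)"
    using admissible_if_two_fixed_points[of n "v 0" E] v E fwd(1) bwd(1) ne vp by blast
  moreover have "run n E (v 0) (\<lambda>i. u (int i) 0) (\<lambda>i. v (int i))"
    using fwd(1)[of "int i" for i] fwd(2)[of _ "int i" for i] ne[of "int i" for i]
    by (auto simp: run_iff edge_choice_def add.commute of_nat_diff)
  moreover have "run n E (v 0) (\<lambda>i. - u (- int i - 1) 0) (\<lambda>i. v (- int i))"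
    unfolding run_iff
  proof (intro conjI allI impI)
    fix i l
    have "- int (Suc i) = - int i - 1"
      by simp
    then show "v (- int (Suc i)) l = evolve_v (v (- int i)) (- u (- int i - 1) 0) l" if "l < n"
      using bwd(2)[OF that, of "- int i"] by (simp only:)
    show "edge_choice n E (\<lambda>i. - u (- int i - 1) 0) (\<lambda>i. v (- int i)) i (- u (- int i - 1) 0)"
      using bwd(1)[of "- int i"] ne[of "- int i"]
      by (auto simp: edge_choice_def of_nat_diff)
  qed simp
  moreover have "- u (- 1) 0 \<noteq> u 0 0"
    using ne[of 0] by simp
  ultimately show ?thesis
    unfolding curve_of_run_def using dc u0
    by (intro exI[of _ E] exI[of _ "v 0"] exI[of _ "\<lambda>i. u (int i) 0"] exI[of _ "\<lambda>i. v (int i)"]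
        conjI exI[of _ "\<lambda>i. - u (- int i - 1) 0"] exI[of _ "\<lambda>i. v (- int i)"]) auto
qed

text \<open>The iteration never gets stuck: every row reached is admissible, which keeps
  \<open>v\<close> off the sphere, provides two fixed points and makes the conjugating factors
  invertible.\<close>

lemma algorithm_step:
  assumes adm: "admissible n E v0" and r: "run_upto n E v0 N u v"
  shows "l < n \<Longrightarrow> v N l \<notin> S2"
    and "if N = 0 then card {w. edge_choice n E u v N w} = 2 else \<exists>!w. edge_choice n E u v N w"
    and "edge_choice n E u v N w \<Longrightarrow> l < n \<Longrightarrow> v N l - evolve_u (v N) w l \<noteq> 0"
proof -
  have admN: "admissible n E (v N)"
    using run_upto_admissible[OF adm r] by simp
  then show vS: "l < n \<Longrightarrow> v N l \<notin> S2" for l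
    by (simp add: admissible_def)
  show "if N = 0 then card {w. edge_choice n E u v N w} = 2 else \<exists>!w. edge_choice n E u v N w"
  proof (cases N)
    case 0
    then have "edge_choice n E u v N = fixed_point (monodromy n E (v N))"
      by (simp add: fun_eq_iff edge_choice_def)
    then show ?thesis
      using card_fixed_points_admissible[OF admN] 0 by simp
  next
    case (Suc i)
    then have fixed: "fixed_point (monodromy n E (v i)) (u i)"
      and "\<And>l. l < n \<Longrightarrow> v N l = evolve_v (v i) (u i) l"
      using r by (auto simp: run_upto_def edge_choice_def)
    then have "edge_choice n E u v N =
        (\<lambda>y. fixed_point (monodromy n E (evolve_v (v i) (u i))) y \<and> y \<noteq> - u i)"
      using monodromy_cong[of n "v N" "evolve_v (v i) (u i)" E] Suc
      by (simp add: fun_eq_iff edge_choice_def)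
    then show ?thesis
      using unique_next_edge[of n E "v i" "u i"] run_upto_admissible[OF adm r, of i] Suc fixed
      by simp
  qed
  show "edge_choice n E u v N w \<Longrightarrow> l < n \<Longrightarrow> v N l - evolve_u (v N) w l \<noteq> 0"
    using evolve_diff_nonzero[of n "v N" w l] vS by (simp add: edge_choice_def fixed_point_def)
qed

theorem theorem3p5:
  fixes n :: nat
  assumes "n \<ge> 1"
  shows
    "(\<forall>E v0. admissible n E v0 \<longrightarrow>
       (\<forall>N u v. run_upto n E v0 N u v \<longrightarrow>
          (\<forall>l<n. v N l \<notin> S2) \<and>
          (if N = 0 then card {w. edge_choice n E u v N w} = 2
           else (\<exists>!w. edge_choice n E u v N w)) \<and>
          (\<forall>w. edge_choice n E u v N w \<longrightarrow> (\<forall>l<n. v N l - evolve_u (v N) w l \<noteq> 0))) \<and>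
       (\<forall>w. fixed_point (monodromy n E v0) w \<longrightarrow> (\<exists>u v. run n E v0 u v \<and> u 0 = w)) \<and>
       (\<forall>u v. run n E v0 u v \<longrightarrow>
          (\<exists>\<gamma>. curve_of_run n E v0 u \<gamma>) \<and>
          (\<forall>\<gamma>. curve_of_run n E v0 u \<gamma> \<longrightarrow> n_invariant n \<gamma>))) \<and>
     (\<forall>\<gamma>. n_invariant n \<gamma> \<longrightarrow>
       (\<exists>E v0 u v. admissible n E v0 \<and> run n E v0 u v \<and> curve_of_run n E v0 u \<gamma>))"
  using algorithm_step run_exists curve_of_run_exists curve_of_run_n_invariant
    n_invariant_imp_curve_of_run
  by (intro conjI allI impI) blast+

end
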